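(* Let $\frac25\leq p\leq\frac12$, and let $\mathcal F\subset 2^{[n]}$ be a shifted non-trivial $3$-wise intersecting family. If $\mathcal F\not\subset\mathrm{BD}_3(n)$, then $\mu_p(\mathcal F)<\mu_p(\mathrm{BD}_3(n))-0.0018$.
   Context: Let $[n]=\{1,2,\ldots,n\}$ and let $2^{[n]}$ be its power set. For $0<p<1$, $q=1-p$, the $p$-measure of a family $\mathcal G\subset 2^{[n]}$ is $\mu_p(\mathcal G)=\sum_{G\in\mathcal G}p^{|G|}q^{n-|G|}$. A family $\mathcal G\subset 2^{[n]}$ is $3$-wise intersecting if $G_1\cap G_2\cap G_3\neq\emptyset$ for all $G_1,G_2,G_3\in\mathcal G$ (not necessarily distinct); it is non-trivial if $\bigcap_{G\in\mathcal G}G=\emptyset$. (Non-trivial $3$-wise intersecting families exist only for $n\ge4$.) The family $\mathrm{BD}_3(n)$ is $\{F\in 2^{[n]}:|F\cap[4]|\geq 3\}$; its $p$-measure is $4p^3q+p^4$ for $n\ge 4$. A family $\mathcal F\subset 2^{[n]}$ is shifted if, whenever $F\in\mathcal F$ and $1\leq i<j\leq n$ satisfy $F\cap\{i,j\}=\{j\}$, then $(F\setminus\{j\})\cup\{i\}\in\mathcal F$. *)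

theory Defs
  imports Complex_Main
begin

definition p_measure :: "nat \<Rightarrow> real \<Rightarrow> nat set set \<Rightarrow> real" where
  "p_measure n p \<G> = (\<Sum>G\<in>\<G>. p ^ card G * (1 - p) ^ (n - card G))"

(* The three members are not required to be distinct. *)
definition three_wise_intersecting :: "nat set set \<Rightarrow> bool" where
  "three_wise_intersecting \<G> \<longleftrightarrow>
     (\<forall>G1\<in>\<G>. \<forall>G2\<in>\<G>. \<forall>G3\<in>\<G>. G1 \<inter> G2 \<inter> G3 \<noteq> {})"

(* The empty family does not count as non-trivial, since \<Inter>{} = UNIV. *)
definition nontrivial :: "nat set set \<Rightarrow> bool" where
  "nontrivial \<G> \<longleftrightarrow> \<Inter>\<G> = {}"

definition BD3 :: "nat \<Rightarrow> nat set set" where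
  "BD3 n = {F \<in> Pow {1..n}. card (F \<inter> {1..4}) \<ge> 3}"

definition shifted :: "nat \<Rightarrow> nat set set \<Rightarrow> bool" where
  "shifted n \<F> \<longleftrightarrow>
     (\<forall>F\<in>\<F>. \<forall>i j. 1 \<le> i \<and> i < j \<and> j \<le> n \<and> F \<inter> {i, j} = {j} \<longrightarrow>
        (F - {j}) \<union> {i} \<in> \<F>)"

end

(*
In a shifted 3-wise intersecting family any three members A, B, C have a prefix [l] with
|A n [l]| + |B n [l]| + |C n [l]| > 2l.  This passes to the closure of the family under domination
of prefix counts, and only this property is used.

Split the closure by the trace S on [4].  The tail of a member is a walk with steps +1 (element
present) and -2 (element absent).  If the classes S and T contain walks that stay below the heights
s and t, then the prefix property forces every walk of a class U to reach a height that is
determined by s, t and |S| + |T| + |U|, and a walk reaches height h with probability at most b^h,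
where b is the root of p + (1 - p) b^3 = b.  If a class S is nonempty, the classes T and U are cross
intersecting, hence their measures sum to at most 1, or are at most p when T = U.  The sets [2, n]
and {1, 2} u [5, n] lie in the closure, because the family is nontrivial and not contained in
BD_3(n).  Distinguishing the minimal heights of the classes {2,3}, {1,2} and {2,3,4} gives six cases;
in each of them a linear combination of these bounds is below the required value.
*)

theory Submission
  imports Defs "HOL-Analysis.Convex"
begin

section \<open>Product measure on boolean lists\<close>

fun mass :: "real \<Rightarrow> nat \<Rightarrow> (bool list \<Rightarrow> bool) \<Rightarrow> real" where
  "mass p 0 P = of_bool (P [])"
| "mass p (Suc n) P =
     p * mass p n (\<lambda>xs. P (True # xs)) + (1 - p) * mass p n (\<lambda>xs. P (False # xs))"

abbreviation trues :: "nat \<Rightarrow> bool list \<Rightarrow> nat" where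
  "trues l xs \<equiv> count_list (take l xs) True"

definition up_closed :: "nat \<Rightarrow> (bool list \<Rightarrow> bool) \<Rightarrow> bool" where
  "up_closed n P \<longleftrightarrow>
     (\<forall>xs ys. length xs = n \<longrightarrow> list_all2 (\<le>) xs ys \<longrightarrow> P xs \<longrightarrow> P ys)"

lemma up_closed_Cons:
  assumes "up_closed (Suc n) P"
  shows "up_closed n (\<lambda>xs. P (b # xs))"
  using assms unfolding up_closed_def by (metis length_Cons list.rel_intros(2) order_refl)

lemma up_closed_False_True:
  assumes "up_closed (Suc n) P" "length xs = n" "P (False # xs)"
  shows "P (True # xs)"
proof -
  have "list_all2 (\<le>) (False # xs) (True # xs)"
    by (simp add: list.rel_refl)
  then show ?thesis
    using assms unfolding up_closed_def by (metis length_Cons)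
qed

lemma mass_mono:
  assumes "0 \<le> p" "p \<le> 1" "\<And>xs. length xs = n \<Longrightarrow> P xs \<Longrightarrow> P' xs"
  shows "mass p n P \<le> mass p n P'"
  using assms(3)
proof (induction n arbitrary: P P')
  case (Suc n)
  have "mass p n (\<lambda>xs. P (b # xs)) \<le> mass p n (\<lambda>xs. P' (b # xs))" for b
    by (rule Suc.IH) (use Suc.prems in simp)
  then show ?case
    using assms(1,2) by (simp add: add_mono mult_left_mono)
qed simp

lemma mass_const: "mass p n (\<lambda>_. c) = of_bool c"
  by (induction n) (auto simp: algebra_simps)

lemma mass_nonneg: "0 \<le> p \<Longrightarrow> p \<le> 1 \<Longrightarrow> 0 \<le> mass p n P"
  by (induction n arbitrary: P) auto

lemma mass_le_1:
  assumes "0 \<le> p" "p \<le> 1"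
  shows "mass p n P \<le> 1"
  using mass_mono[OF assms, of n P "\<lambda>_. True"] by (simp add: mass_const)

lemma mass_Not: "mass p n (\<lambda>xs. \<not> P xs) = 1 - mass p n P"
proof (induction n arbitrary: P)
  case (Suc n)
  show ?case
    unfolding mass.simps Suc.IH[of "\<lambda>xs. P (_ # xs)"] by (simp add: algebra_simps)
qed simp

lemma mass_map_Not: "mass p n (\<lambda>xs. P (map Not xs)) = mass (1 - p) n P"
proof (induction n arbitrary: P)
  case (Suc n)
  show ?case
    using Suc.IH[of "\<lambda>xs. P (True # xs)"] Suc.IH[of "\<lambda>xs. P (False # xs)"] by simp
qed simp

lemma mass_False_le_True:
  assumes "0 \<le> p" "p \<le> 1" "up_closed (Suc n) P"
  shows "mass p n (\<lambda>xs. P (False # xs)) \<le> mass p n (\<lambda>xs. P (True # xs))"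
  using assms by (intro mass_mono) (auto intro: up_closed_False_True)

lemma mass_mono_prob:
  assumes "0 \<le> p" "p \<le> r" "r \<le> 1" "up_closed n P"
  shows "mass p n P \<le> mass r n P"
  using assms(4)
proof (induction n arbitrary: P)
  case (Suc n)
  let ?m = "\<lambda>p b. mass p n (\<lambda>xs. P (b # xs))"
  have le: "?m p b \<le> ?m r b" for b
    by (rule Suc.IH) (rule up_closed_Cons[OF Suc.prems])
  have "p * ?m p True + (1 - p) * ?m p False \<le> p * ?m r True + (1 - p) * ?m r False"
    using assms le by (intro add_mono mult_left_mono) auto
  also have "\<dots> = ?m r False + p * (?m r True - ?m r False)"
    by (simp add: algebra_simps)
  also have "\<dots> \<le> ?m r False + r * (?m r True - ?m r False)"
    using mass_False_le_True[of r n P] assms Suc.prems by (simp add: mult_right_mono)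
  also have "\<dots> = r * ?m r True + (1 - r) * ?m r False"
    by (simp add: algebra_simps)
  finally show ?case by simp
qed simp

lemma powr_two_point:
  fixes a b c r :: real
  assumes "0 \<le> b" "b \<le> a" "0 < r" "r < 1" "1 \<le> c"
  shows "r powr c * a powr c + (1 - r powr c) * b powr c \<le> (r * a + (1 - r) * b) powr c"
proof (cases "b = 0 \<or> a = b")
  case True
  then show ?thesis
  proof
    assume "b = 0"
    then show ?thesis using assms by (simp add: powr_mult)
  next
    assume "a = b"
    then show ?thesis by (simp add: algebra_simps)
  qed
next
  case False
  then have b: "0 < b" "b < a" using assms by auto
  define z where "z = r * a + (1 - r) * b"
  define y where "y = r * b"
  have zy: "z - y = r * (a - b) + (1 - r) * b" by (simp add: z_def y_def algebra_simps)
  have pos: "0 < r * (a - b)" "0 < (1 - r) * b" using assms b by auto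
  define t where "t = r * (a - b) / (z - y)"
  have t: "0 < t" "t < 1" using pos by (auto simp: t_def zy)
  have tz: "t * (z - y) = r * (a - b)" using pos by (simp add: t_def zy)
  have y: "0 < y" using assms b by (simp add: y_def)
  have z: "0 < z" using y zy pos by linarith
  have conv: "convex_on {0<..} (\<lambda>x::real. x powr c)" by (rule powr_convex) (fact assms)
  have "((1 - t) * y + t * z) powr c \<le> (1 - t) * y powr c + t * z powr c"
    using convex_onD[OF conv, of t y z] t y z by simp
  moreover have "((1 - t) * z + t * y) powr c \<le> (1 - t) * z powr c + t * y powr c"
    using convex_onD[OF conv, of t z y] t y z by simp
  moreover have "(1 - t) * y + t * z = r * a"
    using tz by (simp add: y_def algebra_simps)
  moreover have "(1 - t) * z + t * y = b"
    using tz zy by (simp add: y_def algebra_simps)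
  ultimately have "(r * a) powr c + b powr c \<le> z powr c + y powr c"
    by (simp add: algebra_simps)
  then show ?thesis
    using assms by (simp add: z_def y_def powr_mult algebra_simps)
qed

lemma mass_powr:
  assumes "0 < r" "r < 1" "1 \<le> c" "up_closed n P"
  shows "mass (r powr c) n P \<le> mass r n P powr c"
  using assms(4)
proof (induction n arbitrary: P)
  case (Suc n)
  let ?p = "r powr c"
  let ?m = "\<lambda>p b. mass p n (\<lambda>xs. P (b # xs))"
  have p: "0 \<le> ?p" "?p \<le> 1" using assms by (auto simp: powr_le1)
  have "?m ?p b \<le> ?m r b powr c" for b
    by (rule Suc.IH) (rule up_closed_Cons[OF Suc.prems])
  then have "?p * ?m ?p True + (1 - ?p) * ?m ?p False
      \<le> ?p * ?m r True powr c + (1 - ?p) * ?m r False powr c"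
    using p by (intro add_mono mult_left_mono) auto
  also have "\<dots> \<le> (r * ?m r True + (1 - r) * ?m r False) powr c"
    using assms Suc.prems mass_False_le_True[of r n P] mass_nonneg[of r n]
    by (intro powr_two_point) auto
  finally show ?case by simp
qed simp

lemma mass_cross_intersecting:
  assumes "0 \<le> p" "p \<le> 1/2" "up_closed n R"
    and "\<And>xs. length xs = n \<Longrightarrow> P xs \<Longrightarrow> \<not> R (map Not xs)"
  shows "mass p n P + mass p n R \<le> 1"
proof -
  have "mass p n P \<le> mass p n (\<lambda>xs. \<not> R (map Not xs))"
    using assms by (intro mass_mono) auto
  also have "\<dots> = 1 - mass (1 - p) n R"
    by (simp add: mass_Not mass_map_Not)
  also have "\<dots> \<le> 1 - mass p n R"
    using assms mass_mono_prob[of p "1 - p" n R] by simp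
  finally show ?thesis by simp
qed

text \<open>The function \<open>log\<^sub>p \<mu>\<^sub>p\<close> of an up-set decreases in \<open>p\<close>, and
  the case \<open>p = 1/2\<close> is the complement argument.\<close>

lemma mass_intersecting:
  assumes "0 < p" "p \<le> 1/2" "up_closed n P"
    and "\<And>xs. length xs = n \<Longrightarrow> P xs \<Longrightarrow> \<not> P (map Not xs)"
  shows "mass p n P \<le> p"
proof -
  define c where "c = ln p / ln (1/2)"
  have "ln p \<le> ln (1/2)" using assms by (subst ln_le_cancel_iff) auto
  then have c: "1 \<le> c" by (simp add: c_def field_simps)
  have pc: "(1/2) powr c = p" using assms by (simp add: c_def powr_def)
  have half: "mass (1/2) n P \<le> 1/2"
    using mass_cross_intersecting[of "1/2" n P P] assms by simp
  have "mass p n P \<le> mass (1/2) n P powr c"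
    using mass_powr[of "1/2" c n P] c assms(3) by (simp add: pc)
  also have "\<dots> \<le> (1/2) powr c"
    using half c mass_nonneg[of "1/2" n P] by (intro powr_mono2) auto
  finally show ?thesis by (simp add: pc)
qed

text \<open>\<open>True\<close> is a step \<open>+1\<close> and \<open>False\<close> a step \<open>-2\<close> of a walk that reaches height \<open>s\<close>.\<close>

definition reach :: "nat \<Rightarrow> bool list \<Rightarrow> bool" where
  "reach s xs \<longleftrightarrow> (\<exists>l\<le>length xs. 2 * l + s \<le> 3 * trues l xs)"

lemma reach_True:
  assumes "reach (Suc s) (True # xs)"
  shows "reach s xs"
proof -
  obtain l where l: "l \<le> Suc (length xs)" "2 * l + Suc s \<le> 3 * trues l (True # xs)"
    using assms by (auto simp: reach_def)
  then show ?thesis by (cases l) (auto simp: reach_def)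
qed

lemma reach_False:
  assumes "reach (Suc s) (False # xs)"
  shows "reach (s + 3) xs"
proof -
  obtain l where l: "l \<le> Suc (length xs)" "2 * l + Suc s \<le> 3 * trues l (False # xs)"
    using assms by (auto simp: reach_def)
  then show ?thesis by (cases l) (auto simp: reach_def)
qed

lemma mass_reach:
  assumes p: "0 \<le> p" "p \<le> 1" and b: "0 \<le> b" "p + (1 - p) * b ^ 3 \<le> b"
  shows "mass p n (reach s) \<le> b ^ s"
proof (induction n arbitrary: s)
  case 0
  show ?case using b by (cases s) (auto simp: reach_def)
next
  case (Suc n)
  show ?case
  proof (cases s)
    case 0
    then show ?thesis using mass_le_1[OF p, of "Suc n" "reach s"] by simp
  next
    case (Suc t)
    have "mass p (Suc n) (reach s)
        \<le> p * mass p n (reach t) + (1 - p) * mass p n (reach (t + 3))"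
      unfolding mass.simps Suc using p
      by (intro add_mono mult_left_mono mass_mono) (auto intro: reach_True reach_False)
    also have "\<dots> \<le> p * b ^ t + (1 - p) * b ^ (t + 3)"
      using p by (intro add_mono mult_left_mono Suc.IH) auto
    also have "\<dots> = b ^ t * (p + (1 - p) * b ^ 3)"
      by (simp add: algebra_simps power_add)
    also have "\<dots> \<le> b ^ t * b"
      using b by (intro mult_left_mono) auto
    finally show ?thesis using Suc by (simp add: mult.commute)
  qed
qed

section \<open>From set families to boolean lists\<close>

definition bits :: "nat \<Rightarrow> nat \<Rightarrow> nat set \<Rightarrow> bool list" where
  "bits k n G = map (\<lambda>i. i \<in> G) [k..<k + n]"

lemma bits_0: "bits k 0 G = []"
  by (simp add: bits_def)

lemma bits_Suc: "bits k (Suc n) G = (k \<in> G) # bits (Suc k) n G"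
  by (simp add: bits_def upt_rec)

lemma length_bits [simp]: "length (bits k n G) = n"
  by (simp add: bits_def)

lemma bits_insert_less: "i < k \<Longrightarrow> bits k n (insert i G) = bits k n G"
  by (auto simp: bits_def)

lemma trues_bits:
  "l \<le> n \<Longrightarrow> trues l (bits k n G) = card (G \<inter> {k..<k + l})"
proof (induction l arbitrary: k n)
  case (Suc l)
  obtain n' where n: "n = Suc n'" "l \<le> n'" using Suc.prems by (cases n) auto
  have eq: "{k..<k + Suc l} = insert k {Suc k..<Suc k + l}" by auto
  show ?case using Suc.IH[OF n(2), of "Suc k"] unfolding n(1) bits_Suc eq
    by (auto simp: Int_insert_right)
qed simp

lemma mass_eq_sum:
  "(\<Sum>G\<in>Pow {k..<k + n}. p ^ card G * (1 - p) ^ (n - card G) * of_bool (P (bits k n G)))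
     = mass p n P"
proof (induction n arbitrary: k P)
  case 0
  show ?case by (simp add: bits_0)
next
  case (Suc n)
  let ?I = "{Suc k..<Suc k + n}"
  let ?w = "\<lambda>n G. p ^ card G * (1 - p) ^ (n - card G)"
  let ?f = "\<lambda>G. ?w (Suc n) G * of_bool (P (bits k (Suc n) G))"
  have fin: "finite G" and le: "card G \<le> n" and notin: "k \<notin> G" if "G \<in> Pow ?I" for G
    using that finite_subset[of G ?I] card_mono[of ?I G] by auto
  have eq: "{k..<k + Suc n} = insert k ?I" by auto
  have inj: "inj_on (insert k) (Pow ?I)"
    by (rule inj_onI) (use notin in \<open>metis Diff_insert_absorb\<close>)
  have t: "?f (insert k G) = p * (?w n G * of_bool (P (True # bits (Suc k) n G)))"
    if "G \<in> Pow ?I" for G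
    using fin[OF that] notin[OF that] by (simp add: bits_Suc bits_insert_less)
  have f: "?f G = (1 - p) * (?w n G * of_bool (P (False # bits (Suc k) n G)))"
    if "G \<in> Pow ?I" for G
    using le[OF that] notin[OF that] by (simp add: bits_Suc Suc_diff_le)
  have "sum ?f (Pow {k..<k + Suc n}) = sum ?f (Pow ?I) + sum ?f (insert k ` Pow ?I)"
    unfolding eq Pow_insert by (rule sum.union_disjoint) (use notin in auto)
  also have "sum ?f (insert k ` Pow ?I) = (\<Sum>G\<in>Pow ?I. ?f (insert k G))"
    by (simp only: sum.reindex[OF inj] o_def)
  also have "\<dots> = p * mass p n (\<lambda>xs. P (True # xs))"
    unfolding Suc.IH[of "\<lambda>xs. P (True # xs)" "Suc k", symmetric] sum_distrib_left
    by (rule sum.cong[OF refl t])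
  also have "sum ?f (Pow ?I) = (1 - p) * mass p n (\<lambda>xs. P (False # xs))"
    unfolding Suc.IH[of "\<lambda>xs. P (False # xs)" "Suc k", symmetric] sum_distrib_left
    by (rule sum.cong[OF refl f])
  finally show ?case by simp
qed

lemma p_measure_bits:
  "p_measure n p {G \<in> Pow {1..n}. P (bits 1 n G)} = mass p n P"
proof -
  have eq: "{1..n} = {1..<1 + n}" by auto
  have fin: "finite (Pow {1..<1 + n})" by simp
  show ?thesis
    unfolding p_measure_def eq mass_eq_sum[where k = 1, symmetric]
    unfolding sum.inter_filter[OF fin] by (rule sum.cong) auto
qed

lemma p_measure_mono:
  assumes "0 \<le> p" "p \<le> 1" "\<F> \<subseteq> \<G>" "finite \<G>"
  shows "p_measure n p \<F> \<le> p_measure n p \<G>"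
  unfolding p_measure_def using assms by (intro sum_mono2) auto

section \<open>Prefix counts of shifted families\<close>

text \<open>If the prefix condition fails, shifting the least common element of the three sets to a
  position that two of them miss preserves the failure, and it decreases the sum of the elements.\<close>

lemma shifted_prefix_condition:
  assumes sub: "\<F> \<subseteq> Pow {1..n}" and sh: "shifted n \<F>" and tri: "three_wise_intersecting \<F>"
    and "A \<in> \<F>" "B \<in> \<F>" "C \<in> \<F>"
  shows "\<exists>l\<le>n. 2 * l < card (A \<inter> {1..l}) + card (B \<inter> {1..l})
      + card (C \<inter> {1..l})"
  using assms(4-6)
proof (induction "\<Sum>A + \<Sum>B + \<Sum>C" arbitrary: A B C rule: less_induct)
  case less
  define N where "N i = of_bool (i \<in> A) + of_bool (i \<in> B)
      + (of_bool (i \<in> C) :: nat)" for i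
  have card_eq: "card (G \<inter> {1..l}) = (\<Sum>i=1..l. of_bool (i \<in> G))" for G and l :: nat
    by (simp add: Int_commute)
  have N: "card (A \<inter> {1..l}) + card (B \<inter> {1..l})
      + card (C \<inter> {1..l}) = (\<Sum>i=1..l. N i)" for l
    unfolding N_def card_eq by (simp add: sum.distrib)
  have fin: "finite G" if "G \<in> \<F>" for G
    using that sub finite_subset by blast
  show ?case
  proof (rule ccontr)
    assume "\<not> ?thesis"
    then have low: "(\<Sum>i=1..l. N i) \<le> 2 * l" if "l \<le> n" for l
      using that unfolding N by (meson not_less)
    have "A \<inter> B \<inter> C \<noteq> {}"
      using tri less.prems unfolding three_wise_intersecting_def by blast
    define j where "j = (LEAST j. j \<in> A \<inter> B \<inter> C)"
    have j: "j \<in> A" "j \<in> B" "j \<in> C"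
      using LeastI_ex[of "\<lambda>j. j \<in> A \<inter> B \<inter> C"] \<open>A \<inter> B \<inter> C \<noteq> {}\<close> by (auto simp: j_def)
    have jn: "1 \<le> j" "j \<le> n" using j(1) less.prems(1) sub by (auto dest!: subsetD)
    have N2: "N i \<le> 2" if "i < j" for i
      using not_less_Least[of i "\<lambda>j. j \<in> A \<inter> B \<inter> C"] that by (auto simp: N_def j_def)
    have split: "{1..j} = insert j {1..<j}" using jn by auto
    have "N j = 3" using j by (simp add: N_def)
    then have "3 + (\<Sum>i=1..<j. N i) \<le> 2 * j"
      using low[OF jn(2)] unfolding split by simp
    moreover have "2 * (j - 1) \<le> (\<Sum>i=1..<j. N i)" if "\<forall>i\<in>{1..<j}. 2 \<le> N i"
      using sum_bounded_below[of "{1..<j}" 2 N] that by simp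
    ultimately obtain i where i: "1 \<le> i" "i < j" "N i \<le> 1"
      using jn by fastforce
    have step: False
      if mem: "X \<in> \<F>" "Y \<in> \<F>" "Z \<in> \<F>" and jX: "j \<in> X" and iX: "i \<notin> X"
        and sums: "\<Sum>X + \<Sum>Y + \<Sum>Z = \<Sum>A + \<Sum>B + \<Sum>C"
        and N': "\<And>i. of_bool (i \<in> X) + of_bool (i \<in> Y)
            + of_bool (i \<in> Z) = N i" for X Y Z
    proof -
      define X' where "X' = (X - {j}) \<union> {i}"
      have X': "X' \<in> \<F>"
        unfolding X'_def using sh mem(1) jX iX i jn unfolding shifted_def by blast
      have "\<Sum>X' = \<Sum>(X - {j}) + i"
        unfolding X'_def using iX fin[OF mem(1)] i by (subst sum.union_disjoint) auto
      also have "\<dots> < \<Sum>X"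
        using i(2) sum.remove[OF fin[OF mem(1)] jX, of "\<lambda>x. x"] by simp
      finally have "\<Sum>X' + \<Sum>Y + \<Sum>Z < \<Sum>A + \<Sum>B + \<Sum>C" using sums by simp
      from less.hyps[OF this X' mem(2,3)] obtain l where l: "l \<le> n"
        "2 * l < card (X' \<inter> {1..l}) + card (Y \<inter> {1..l})
            + card (Z \<inter> {1..l})" by blast
      define N' where "N' a = of_bool (a \<in> X') + of_bool (a \<in> Y)
          + (of_bool (a \<in> Z) :: nat)" for a
      have l2: "2 * l < (\<Sum>a=1..l. N' a)"
        using l(2) unfolding N'_def card_eq by (simp add: sum.distrib)
      have eq: "N' a = N a" if "a \<noteq> i" "a \<noteq> j" for a
        using that N'[of a] by (simp add: N'_def X'_def)
      have i': "N' i = N i + 1" using N'[of i] iX i by (simp add: N'_def X'_def)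
      have j': "N' j + 1 = N j" using N'[of j] jX i by (simp add: N'_def X'_def)
      consider "l < i" | "i \<le> l" "l < j" | "j \<le> l" by linarith
      then show False
      proof cases
        case 1
        then have "(\<Sum>a=1..l. N' a) = (\<Sum>a=1..l. N a)"
          using i by (intro sum.cong) (auto intro: eq)
        then show False using l2 low[OF l(1)] by simp
      next
        case 2
        have "(\<Sum>a=1..l. N' a) \<le> (\<Sum>a=1..l. 2)"
        proof (rule sum_mono)
          fix a assume "a \<in> {1..l}"
          then show "N' a \<le> 2"
            using 2 i(3) i' eq[of a] N2[of a] by (cases "a = i") auto
        qed
        then show False using l2 by simp
      next
        case 3
        have split: "sum f {1..l} = f i + (f j + sum f ({1..l} - {i} - {j}))"
          for f :: "nat \<Rightarrow> nat"
          using sum.remove[of "{1..l}" i f] sum.remove[of "{1..l} - {i}" j f] 3 i jn by simp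
        have "sum N' ({1..l} - {i} - {j}) = sum N ({1..l} - {i} - {j})"
          by (rule sum.cong) (auto intro: eq)
        then show False using l2 low[OF l(1)] i' j' unfolding split by linarith
      qed
    qed
    have "i \<notin> A \<or> i \<notin> B" using i(3) by (auto simp: N_def split: if_splits)
    then show False
    proof
      assume "i \<notin> A"
      then show False using step[of A B C] less.prems j by (simp add: N_def)
    next
      assume "i \<notin> B"
      then show False using step[of B A C] less.prems j by (simp add: N_def)
    qed
  qed
qed

definition dominated :: "bool list \<Rightarrow> bool list \<Rightarrow> bool" where
  "dominated xs ys \<longleftrightarrow> length xs = length ys \<and> (\<forall>l. trues l xs \<le> trues l ys)"

lemma dom_append: "dominated xs ys \<Longrightarrow> dominated (xs @ zs) (ys @ zs)"
  by (simp add: dominated_def)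

lemma dom_append_right: "dominated xs ys \<Longrightarrow> dominated (zs @ xs) (zs @ ys)"
  by (simp add: dominated_def)

lemma dom_list_all2:
  "list_all2 (\<le>) xs ys \<Longrightarrow> dominated xs ys"
proof (induction rule: list_all2_induct)
  case (Cons x xs y ys)
  then show ?case by (cases x; cases y) (auto simp: dominated_def take_Cons' intro: le_SucI)
qed (simp add: dominated_def)

lemma trues_replicate: "trues l (replicate m True) = min l m"
  by (induction m arbitrary: l) (auto simp: take_Cons')

lemma trues_le: "trues l xs \<le> min l (length xs)"
  using count_le_length[of "take l xs" True] by simp

lemma dom_replicate: "length xs = m \<Longrightarrow> dominated xs (replicate m True)"
  using trues_le[of _ xs] by (simp add: dominated_def trues_replicate del: take_replicate)

lemma trues_map_Not: "l \<le> length xs \<Longrightarrow> trues l xs + trues l (map Not xs) = l"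
proof (induction xs arbitrary: l)
  case (Cons x xs)
  then show ?case by (cases l) auto
qed simp

text \<open>No initial segment of the three prefixes forces a common element.\<close>

definition free :: "bool list \<Rightarrow> bool list \<Rightarrow> bool list \<Rightarrow> bool" where
  "free a b c \<longleftrightarrow> (\<forall>l\<le>length a. trues l a + trues l b
      + trues l c \<le> 2 * l)"

locale prefix_family =
  fixes n :: nat and Q :: "bool list \<Rightarrow> bool"
  assumes dom_closed: "Q xs \<Longrightarrow> dominated xs ys \<Longrightarrow> Q ys"
    and prefix_condition:
      "Q xs \<Longrightarrow> Q ys \<Longrightarrow> Q zs \<Longrightarrow> \<exists>l\<le>n. 2 * l < trues l xs + trues l ys + trues l zs"
begin

text \<open>Some member with prefix \<open>a\<close> continues as a walk that never exceeds height \<open>s\<close>.\<close>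

definition low :: "nat \<Rightarrow> bool list \<Rightarrow> nat \<Rightarrow> bool" where
  "low k a s \<longleftrightarrow>
     (\<exists>xs. length xs = n - k \<and> Q (a @ xs) \<and> (\<forall>l. 3 * trues l xs \<le> 2 * l + s))"

lemma low_dom: "low k a s \<Longrightarrow> dominated a b \<Longrightarrow> low k b s"
  unfolding low_def by (meson dom_closed dom_append)

lemma low_nonempty:
  assumes "low k a s"
  shows "Q (a @ replicate (n - k) True)"
proof -
  obtain xs where "length xs = n - k" "Q (a @ xs)"
    using assms by (auto simp: low_def)
  then show ?thesis
    using dom_closed dom_append_right[OF dom_replicate] by blast
qed

lemma up_closed_append: "up_closed m (\<lambda>xs. Q (a @ xs))"
  unfolding up_closed_def by (meson dom_closed dom_append_right dom_list_all2)

lemma prefix_condition_tails: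
  assumes "Q (a @ xs)" "Q (b @ ys)" "Q (c @ zs)" "free a b c"
    and "length a = k" "length b = k" "length c = k" "k \<le> n"
  shows "\<exists>l\<le>n - k. 2 * (k + l) < trues k a + trues k b + trues k c
           + trues l xs + trues l ys + trues l zs"
proof -
  obtain l where l: "l \<le> n" "2 * l < trues l (a @ xs) + trues l (b @ ys) + trues l (c @ zs)"
    using prefix_condition[OF assms(1-3)] by blast
  have "\<not> l \<le> k"
    using l(2) assms(4-7) unfolding free_def by (auto simp: not_less)
  then have "l = k + (l - k)" "l - k \<le> n - k" using l by auto
  moreover have "trues l (a @ xs) = trues k a + trues (l - k) xs"
    "trues l (b @ ys) = trues k b + trues (l - k) ys"
    "trues l (c @ zs) = trues k c + trues (l - k) zs"
    using assms(5-7) \<open>\<not> l \<le> k\<close> by auto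
  ultimately show ?thesis using l(2) by (intro exI[of _ "l - k"] conjI) presburger+
qed

lemma low_low_reach:
  assumes "low k a s" "low k b t" "free a b c" "Q (c @ zs)"
    and len: "length a = k" "length b = k" "length c = k" "k \<le> n" "length zs = n - k"
    and u: "u + s + t + 3 * (trues k a + trues k b + trues k c) \<le> 6 * k + 3"
  shows "reach u zs"
proof -
  obtain xs ys where x: "Q (a @ xs)" "\<And>l. 3 * trues l xs \<le> 2 * l + s"
    and y: "Q (b @ ys)" "\<And>l. 3 * trues l ys \<le> 2 * l + t"
    using assms(1,2) by (auto simp: low_def)
  obtain l where l: "l \<le> n - k" "2 * (k + l) < trues k a + trues k b + trues k c
      + trues l xs + trues l ys + trues l zs"
    using prefix_condition_tails[OF x(1) y(1) assms(4,3)] len by blast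
  have "2 * l + u \<le> 3 * trues l zs"
    using l(2) x(2)[of l] y(2)[of l] u by presburger
  then show ?thesis using l(1) len by (auto simp: reach_def)
qed

lemma not_low_reach:
  assumes "\<not> low k a s" "Q (a @ xs)" "length xs = n - k"
  shows "reach (Suc s) xs"
proof -
  obtain l where l: "2 * l + s < 3 * trues l xs"
    using assms by (auto simp: low_def not_le)
  let ?l = "min l (length xs)"
  have "2 * ?l + Suc s \<le> 3 * trues ?l xs"
    using l by (auto simp: min_def)
  then show ?thesis
    unfolding reach_def by (intro exI[of _ ?l]) auto
qed

lemma cross_intersecting_tails:
  assumes "Q (a @ replicate (n - k) True)" "free a b c" "Q (b @ xs)" "length xs = n - k"
    and "length a = k" "length b = k" "length c = k" "k \<le> n"
  shows "\<not> Q (c @ map Not xs)"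
proof
  assume Qc: "Q (c @ map Not xs)"
  obtain l where l: "l \<le> n - k"
    "2 * (k + l) < trues k a + trues k b + trues k c
       + trues l (replicate (n - k) True) + trues l xs + trues l (map Not xs)"
    using prefix_condition_tails[OF assms(1,3) Qc assms(2,5-8)] by blast
  have "trues l xs + trues l (map Not xs) = l"
    using l(1) assms(4) by (intro trues_map_Not) simp
  moreover have "trues k a + trues k b + trues k c \<le> 2 * k"
    using assms(2,5) unfolding free_def by blast
  ultimately show False using l by (simp add: trues_replicate del: take_replicate)
qed

end

section \<open>Numerical bounds\<close>

definition chord_lo :: "real list" where
  "chord_lo = [1, 183/400, 1047/5000, 959/10000, 439/10000, 201/10000,
     23/2500, 43/10000, 1/500, 1/1000]"

definition chord_hi :: "real list" where
  "chord_hi = [1, 6181/10000, 3821/10000, 1181/5000, 73/500, 903/10000,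
     559/10000, 173/5000, 107/5000, 133/10000]"

definition chord :: "nat \<Rightarrow> real \<Rightarrow> real" where
  "chord k p = chord_lo ! k * (5 - 10 * p) + chord_hi ! k * (10 * p - 4)"

text \<open>The linear function \<open>1.606 p - 0.1849\<close> lies just above the root in \<open>(0, 1)\<close> of
  \<open>p + (1 - p) x\<^sup>3 = x\<close>.  By convexity its powers lie below their chords over \<open>[2/5, 1/2]\<close>,
  whose end values are rounded up to four decimals.\<close>

lemma power_le_chord:
  assumes "2/5 \<le> p" "p \<le> 1/2" "k \<le> 9"
  shows "(1.606 * p - 0.1849) ^ k \<le> chord k p"
proof -
  let ?b = "1.606 * p - 0.1849"
  have b: "0 \<le> ?b" using assms by simp
  have step: "?b * x \<le> a' * (5 - 10 * p) + b' * (10 * p - 4)"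
    if x: "x \<le> a * (5 - 10 * p)
        + b * (10 * p - 4)" and "0.4575 * a \<le> a'" "0.6181 * b \<le> b'" "a \<le> b" for x a b a' b'
  proof -
    have "?b * x \<le> ?b * (a * (5 - 10 * p) + b * (10 * p - 4))"
      using b x by (rule mult_left_mono[rotated])
    also have "\<dots> = 0.4575 * a * (5 - 10 * p) + 0.6181 * b * (10 * p - 4)
        - 0.1606 * ((b - a) * ((5 - 10 * p) * (10 * p - 4)))"
      by algebra
    also have "\<dots> \<le> 0.4575 * a * (5 - 10 * p) + 0.6181 * b * (10 * p - 4)"
      using that assms by simp
    also have "\<dots> \<le> a' * (5 - 10 * p) + b' * (10 * p - 4)"
      using that assms by (intro add_mono mult_right_mono) auto
    finally show ?thesis .
  qed
  have suc: "?b ^ Suc k \<le> chord (Suc k) p" if "?b ^ k \<le> chord k p" "k < 9" for k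
    unfolding power_Suc chord_def
    by (rule step[OF that(1)[unfolded chord_def]])
      (use that(2) in \<open>auto simp: chord_lo_def chord_hi_def less_Suc_eq numeral_eq_Suc\<close>)
  show ?thesis
    using assms(3)
  proof (induction k)
    case 0
    show ?case by (simp add: chord_def chord_lo_def chord_hi_def)
  next
    case (Suc k)
    then show ?case using suc[of k] by simp
  qed
qed

text \<open>The differences are written in the Bernstein basis of \<open>[2/5, 1/2]\<close>, where all coefficients
  are nonnegative; the slack \<open>1/10000\<close> makes the inequalities strict.\<close>

lemma chord_poly_L23_3:
  fixes p :: real
  assumes "2/5 \<le> p" "p \<le> 1/2"
  shows "p ^ 4 + p ^ 3 * (1 - p) * (2 + p) + p ^ 2 * (1 - p) ^ 2 * (5 * chord 3 p)
      + p * (1 - p) ^ 3 * (4 * chord 6 p) + (1 - p) ^ 4 * chord 9 p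
    < 4 * p ^ 3 * (1 - p) + p ^ 4 - 0.0018"
proof -
  define u where "u = 10 * p - 4"
  define v where "v = 5 - 10 * p"
  have "0 \<le> u" "0 \<le> v" using assms by (auto simp: u_def v_def)
  then have "0 \<le> 178823/6250000 * v ^ 5
      + 353739/3125000 * u * v ^ 4
      + 168853/1000000 * u ^ 2 * v ^ 3
      + 115933/1000000 * u ^ 3 * v ^ 2
      + 27951/800000 * u ^ 4 * v ^ 1
      + 517/160000 * u ^ 5"
    by (intro add_nonneg_nonneg mult_nonneg_nonneg zero_le_power) auto
  also have "\<dots> = 4 * p ^ 3 * (1 - p) + p ^ 4 - 0.0018 - 1/10000 - (p ^ 4
      + p ^ 3 * (1 - p) * (2 + p) + p ^ 2 * (1 - p) ^ 2 * (5 * chord 3 p)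
      + p * (1 - p) ^ 3 * (4 * chord 6 p) + (1 - p) ^ 4 * chord 9 p)"
    unfolding u_def v_def chord_def by (simp add: chord_lo_def chord_hi_def) algebra
  finally show ?thesis by linarith
qed

lemma chord_poly_L23_L12:
  fixes p :: real
  assumes "2/5 \<le> p" "p \<le> 1/2"
  shows "p ^ 4 + p ^ 3 * (1 - p) * (2 + p) + p ^ 2 * (1 - p) ^ 2 * (chord 1 p + chord 3 p
      + chord 5 p + 2 * chord 4 p) + p * (1 - p) ^ 3 * (2 * chord 6 p + 2 * chord 8 p)
      + (1 - p) ^ 4 * chord 9 p
    < 4 * p ^ 3 * (1 - p) + p ^ 4 - 0.0018"
proof -
  define u where "u = 10 * p - 4"
  define v where "v = 5 - 10 * p"
  have "0 \<le> u" "0 \<le> v" using assms by (auto simp: u_def v_def)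
  then have "0 \<le> 121151/6250000 * v ^ 5
      + 240591/3125000 * u * v ^ 4
      + 117079/1000000 * u ^ 2 * v ^ 3
      + 84921/1000000 * u ^ 3 * v ^ 2
      + 23641/800000 * u ^ 4 * v ^ 1
      + 651/160000 * u ^ 5"
    by (intro add_nonneg_nonneg mult_nonneg_nonneg zero_le_power) auto
  also have "\<dots> = 4 * p ^ 3 * (1 - p) + p ^ 4 - 0.0018 - 1/10000 - (p ^ 4
      + p ^ 3 * (1 - p) * (2 + p) + p ^ 2 * (1 - p) ^ 2 * (chord 1 p + chord 3 p + chord 5 p
      + 2 * chord 4 p) + p * (1 - p) ^ 3 * (2 * chord 6 p + 2 * chord 8 p)
      + (1 - p) ^ 4 * chord 9 p)"
    unfolding u_def v_def chord_def by (simp add: chord_lo_def chord_hi_def) algebra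
  finally show ?thesis by linarith
qed

lemma chord_poly_L23_not_L12:
  fixes p :: real
  assumes "2/5 \<le> p" "p \<le> 1/2"
  shows "p ^ 4 + p ^ 3 * (1 - p) * (2 + p) + p ^ 2 * (1 - p) ^ 2 * (2 * chord 3 p
      + 3 * chord 4 p) + (3 * (p * (1 - p) ^ 3) + p * (1 - 2 * p)) * chord 4 p
      + (1 - p) ^ 4 * chord 7 p
    < 4 * p ^ 3 * (1 - p) + p ^ 4 - 0.0018"
proof -
  define u where "u = 10 * p - 4"
  define v where "v = 5 - 10 * p"
  have "0 \<le> u" "0 \<le> v" using assms by (auto simp: u_def v_def)
  then have "0 \<le> 79557/3125000 * v ^ 5
      + 112089/1250000 * u * v ^ 4
      + 295277/2500000 * u ^ 2 * v ^ 3
      + 149431/2000000 * u ^ 3 * v ^ 2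
      + 21001/800000 * u ^ 4 * v ^ 1
      + 433/80000 * u ^ 5"
    by (intro add_nonneg_nonneg mult_nonneg_nonneg zero_le_power) auto
  also have "\<dots> = 4 * p ^ 3 * (1 - p) + p ^ 4 - 0.0018 - 1/10000 - (p ^ 4
      + p ^ 3 * (1 - p) * (2 + p) + p ^ 2 * (1 - p) ^ 2 * (2 * chord 3 p + 3 * chord 4 p)
      + (3 * (p * (1 - p) ^ 3) + p * (1 - 2 * p)) * chord 4 p + (1 - p) ^ 4 * chord 7 p)"
    unfolding u_def v_def chord_def by (simp add: chord_lo_def chord_hi_def) algebra
  finally show ?thesis by linarith
qed

lemma chord_poly_not_L23_not_L12:
  fixes p :: real
  assumes "2/5 \<le> p" "p \<le> 1/2"
  shows "p ^ 4 + 3 * (p ^ 3 * (1 - p)) + (p ^ 2 * (1 - p) ^ 2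
      + 2 * (p ^ 2 * (1 - p) ^ 2 - p ^ 3 * (1 - p)) + p * (1 - p) ^ 3 - p ^ 4) * chord 3 p
      + (3 * (p ^ 2 * (1 - p) ^ 2) + 3 * (p * (1 - p) ^ 3) + (1 - p) ^ 4) * chord 5 p
    < 4 * p ^ 3 * (1 - p) + p ^ 4 - 0.0018"
proof -
  define u where "u = 10 * p - 4"
  define v where "v = 5 - 10 * p"
  have "0 \<le> u" "0 \<le> v" using assms by (auto simp: u_def v_def)
  then have "0 \<le> 7949/781250 * v ^ 9
      + 381689/6250000 * u * v ^ 8
      + 1814647/12500000 * u ^ 2 * v ^ 7
      + 2060813/12500000 * u ^ 3 * v ^ 6
      + 1958929/25000000 * u ^ 4 * v ^ 5
      + 687061/100000000 * u ^ 5 * v ^ 4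
      + 25457/1000000 * u ^ 6 * v ^ 3
      + 101347/2000000 * u ^ 7 * v ^ 2
      + 613/20000 * u ^ 8 * v ^ 1
      + 1013/160000 * u ^ 9"
    by (intro add_nonneg_nonneg mult_nonneg_nonneg zero_le_power) auto
  also have "\<dots> = 4 * p ^ 3 * (1 - p) + p ^ 4 - 0.0018 - 1/10000 - (p ^ 4
      + 3 * (p ^ 3 * (1 - p)) + (p ^ 2 * (1 - p) ^ 2
      + 2 * (p ^ 2 * (1 - p) ^ 2 - p ^ 3 * (1 - p)) + p * (1 - p) ^ 3 - p ^ 4) * chord 3 p
      + (3 * (p ^ 2 * (1 - p) ^ 2) + 3 * (p * (1 - p) ^ 3) + (1 - p) ^ 4) * chord 5 p)"
    unfolding u_def v_def chord_def by (simp add: chord_lo_def chord_hi_def) algebra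
  finally show ?thesis by linarith
qed

lemma chord_poly_not_L23_L12_L234:
  fixes p :: real
  assumes "2/5 \<le> p" "p \<le> 1/2"
  shows "p ^ 4 + p ^ 3 * (1 - p) * (3 + p)
      + (p ^ 2 * (1 - p) ^ 2 - p ^ 3 * (1 - p)) * (chord 1 p + 2 * chord 3 p)
      + (p ^ 2 * (1 - p) ^ 2 - p ^ 4) * chord 5 p + p ^ 2 * (1 - p) ^ 2 * (2 * chord 5 p)
      + p * (1 - p) ^ 3 * (2 * chord 6 p + 2 * chord 8 p) + (1 - p) ^ 4 * chord 9 p
    < 4 * p ^ 3 * (1 - p) + p ^ 4 - 0.0018"
proof -
  define u where "u = 10 * p - 4"
  define v where "v = 5 - 10 * p"
  have "0 \<le> u" "0 \<le> v" using assms by (auto simp: u_def v_def)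
  then have "0 \<le> 22811/6250000 * v ^ 8
      + 19743/1250000 * u * v ^ 7
      + 273013/12500000 * u ^ 2 * v ^ 6
      + 392941/50000000 * u ^ 3 * v ^ 5
      + 55127/6250000 * u ^ 4 * v ^ 4
      + 900323/20000000 * u ^ 5 * v ^ 3
      + 250353/4000000 * u ^ 6 * v ^ 2
      + 28639/800000 * u ^ 7 * v ^ 1
      + 1211/160000 * u ^ 8"
    by (intro add_nonneg_nonneg mult_nonneg_nonneg zero_le_power) auto
  also have "\<dots> = 4 * p ^ 3 * (1 - p) + p ^ 4 - 0.0018 - 1/10000 - (p ^ 4
      + p ^ 3 * (1 - p) * (3 + p) + (p ^ 2 * (1 - p) ^ 2 - p ^ 3 * (1 - p)) * (chord 1 p
      + 2 * chord 3 p) + (p ^ 2 * (1 - p) ^ 2 - p ^ 4) * chord 5 p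
      + p ^ 2 * (1 - p) ^ 2 * (2 * chord 5 p) + p * (1 - p) ^ 3 * (2 * chord 6 p
      + 2 * chord 8 p) + (1 - p) ^ 4 * chord 9 p)"
    unfolding u_def v_def chord_def by (simp add: chord_lo_def chord_hi_def) algebra
  finally show ?thesis by linarith
qed

lemma chord_poly_not_L23_L12_not_L234:
  fixes p :: real
  assumes "2/5 \<le> p" "p \<le> 1/2"
  shows "p ^ 2 + p ^ 3 * (1 - p) * chord 2 p + p ^ 2 * (1 - p) ^ 2 * (3 * chord 5 p)
      + p * (1 - p) ^ 3 * (chord 5 p + 2 * chord 8 p) + (1 - p) ^ 4 * chord 9 p
    < 4 * p ^ 3 * (1 - p) + p ^ 4 - 0.0018"
proof -
  define u where "u = 10 * p - 4"
  define v where "v = 5 - 10 * p"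
  have "0 \<le> u" "0 \<le> v" using assms by (auto simp: u_def v_def)
  then have "0 \<le> 22337/6250000 * v ^ 5
      + 46583/2500000 * u * v ^ 4
      + 113371/2500000 * u ^ 2 * v ^ 3
      + 23977/400000 * u ^ 3 * v ^ 2
      + 8057/200000 * u ^ 4 * v ^ 1
      + 851/80000 * u ^ 5"
    by (intro add_nonneg_nonneg mult_nonneg_nonneg zero_le_power) auto
  also have "\<dots> = 4 * p ^ 3 * (1 - p) + p ^ 4 - 0.0018 - 1/10000 - (p ^ 2
      + p ^ 3 * (1 - p) * chord 2 p + p ^ 2 * (1 - p) ^ 2 * (3 * chord 5 p)
      + p * (1 - p) ^ 3 * (chord 5 p + 2 * chord 8 p) + (1 - p) ^ 4 * chord 9 p)"
    unfolding u_def v_def chord_def by (simp add: chord_lo_def chord_hi_def) algebra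
  finally show ?thesis by linarith
qed
section \<open>Families split by their trace on the first four elements\<close>

definition pat :: "nat set \<Rightarrow> bool list" where
  "pat S = [1 \<in> S, 2 \<in> S, 3 \<in> S, 4 \<in> S]"

lemma length_pat [simp]: "length (pat S) = 4"
  by (simp add: pat_def)

definition wt :: "nat set \<Rightarrow> nat" where
  "wt S = of_bool (1 \<in> S) + of_bool (2 \<in> S) + of_bool (3 \<in> S) + of_bool (4 \<in> S)"

lemma trues_pat: "trues 4 (pat S) = wt S" "count_list (pat S) True = wt S"
  by (simp_all add: pat_def wt_def)

lemma all_le_4: "(\<forall>l\<le>4. P l) \<longleftrightarrow> P 0 \<and> P 1 \<and> P 2 \<and> P 3 \<and> P (4::nat)"
  by (auto simp: le_Suc_eq numeral_eq_Suc)

lemma trues_pat_eval: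
  "trues 0 (pat S) = 0"
  "trues 1 (pat S) = of_bool (1 \<in> S)"
  "trues (Suc 0) (pat S) = of_bool (1 \<in> S)"
  "trues 2 (pat S) = of_bool (1 \<in> S) + of_bool (2 \<in> S)"
  "trues 3 (pat S) = of_bool (1 \<in> S) + of_bool (2 \<in> S) + of_bool (3 \<in> S)"
  by (simp_all add: pat_def take_Cons')

lemma free_pat:
  "free (pat S) (pat T) (pat U) \<longleftrightarrow>
     (\<forall>l\<in>{1, 2, 3, 4}. trues l (pat S) + trues l (pat T) + trues l (pat U) \<le> 2 * l)"
  by (simp add: free_def all_le_4)

lemma dom_pat:
  assumes "\<forall>l\<in>{1, 2, 3, 4}. trues l (pat S) \<le> trues l (pat T)"
  shows "dominated (pat S) (pat T)"
  unfolding dominated_def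
proof (intro conjI allI)
  fix l
  have "\<forall>l\<le>4. trues l (pat S) \<le> trues l (pat T)"
    using assms by (simp add: all_le_4)
  then show "trues l (pat S) \<le> trues l (pat T)"
    by (cases "l \<le> 4") (auto dest: spec[of _ 4])
qed simp

lemmas pat_eval = trues_pat_eval trues_pat wt_def

locale nontrivial_prefix_family = prefix_family +
  fixes p :: real
  assumes n: "4 \<le> n" and p: "2/5 \<le> p" "p \<le> 1/2"
    and Q_234: "Q (False # replicate (n - 1) True)"
    and Q_12: "Q ([True, True, False, False] @ replicate (n - 4) True)"
begin

definition X :: "nat set \<Rightarrow> real" where
  "X S = mass p (n - 4) (\<lambda>xs. Q (pat S @ xs))"

abbreviation L :: "nat set \<Rightarrow> nat \<Rightarrow> bool" where
  "L S s \<equiv> low 4 (pat S) s"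

abbreviation full :: "nat set \<Rightarrow> bool" where
  "full S \<equiv> Q (pat S @ replicate (n - 4) True)"

lemma p01: "0 \<le> p" "p \<le> 1" "0 < p"
  using p by auto

lemma mass_reach_chord: "s \<le> 9 \<Longrightarrow> mass p m (reach s) \<le> chord s p"
proof -
  assume s: "s \<le> 9"
  define b where "b = 1.606 * p - 0.1849"
  define u where "u = 10 * p - 4"
  define v where "v = 5 - 10 * p"
  have uv: "0 \<le> u" "0 \<le> v" using p by (auto simp: u_def v_def)
  have b: "0 \<le> b" "b \<le> 1" using p by (auto simp: b_def)
  have "p \<le> (1 - p) * b * (b + 1)"
  proof -
    have "0 \<le> 67/800000 * v ^ 3 + 724001/40000000 * u * v ^ 2
        + 5167329/250000000 * u ^ 2 * v + 14761/200000000 * u ^ 3"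
      using uv by (intro add_nonneg_nonneg mult_nonneg_nonneg zero_le_power) auto
    also have "\<dots> = (1 - p) * b * (b + 1) - p"
      unfolding u_def v_def b_def by simp algebra
    finally show ?thesis by simp
  qed
  then have "0 \<le> (1 - b) * ((1 - p) * b * (b + 1) - p)"
    using b by simp
  also have "\<dots> = b - (p + (1 - p) * b ^ 3)"
    by algebra
  finally have "mass p m (reach s) \<le> b ^ s"
    using p b by (intro mass_reach) auto
  then show ?thesis
    using power_le_chord[OF p s] by (simp add: b_def)
qed

lemma X_nonneg: "0 \<le> X S"
  unfolding X_def using p01 by (intro mass_nonneg)

lemma X_mono:
  assumes "\<forall>l\<in>{1, 2, 3, 4}. trues l (pat S) \<le> trues l (pat T)"
  shows "X S \<le> X T"
  unfolding X_def using p01 dom_closed dom_append[OF dom_pat[OF assms]]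
  by (intro mass_mono) auto

lemma L_mono:
  assumes "L S s" "\<forall>l\<in>{1, 2, 3, 4}. trues l (pat S) \<le> trues l (pat T)"
  shows "L T s"
  using low_dom[OF assms(1) dom_pat[OF assms(2)]] .

lemma X_le_chord:
  assumes "L S s" "L T t" "free (pat S) (pat T) (pat U)"
    and "u + s + t + 3 * (wt S + wt T + wt U) \<le> 27" "u \<le> 9"
  shows "X U \<le> chord u p"
proof -
  have "X U \<le> mass p (n - 4) (reach u)"
    unfolding X_def using p01 n assms low_low_reach[OF assms(1-3)]
    by (intro mass_mono) (auto simp: trues_pat)
  then show ?thesis using mass_reach_chord[OF assms(5)] by (rule order_trans)
qed

lemma X_le_chord_not_L:
  assumes "\<not> L S s" "t = Suc s" "t \<le> 9"
  shows "X S \<le> chord t p"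
proof -
  have "X S \<le> mass p (n - 4) (reach t)"
    unfolding X_def assms(2) using p01 not_low_reach[OF assms(1)] by (intro mass_mono) auto
  then show ?thesis using mass_reach_chord[OF assms(3)] by (rule order_trans)
qed

lemma X_add_le_1:
  assumes "full S" "free (pat S) (pat T) (pat U)"
  shows "X T + X U \<le> 1"
  unfolding X_def using p n cross_intersecting_tails[OF assms]
  by (intro mass_cross_intersecting up_closed_append) auto

lemma X_le_p:
  assumes "full S" "free (pat S) (pat T) (pat T)"
  shows "X T \<le> p"
  unfolding X_def using p n cross_intersecting_tails[OF assms]
  by (intro mass_intersecting up_closed_append) auto

lemma full_234: "full {2, 3, 4}"
proof -
  obtain m where "n = 4 + m" using n by (metis le_Suc_ex)
  then show ?thesis using Q_234 by (simp add: pat_def numeral_eq_Suc)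
qed

lemma full_12: "full {1, 2}"
  using Q_12 by (simp add: pat_def)

lemma L_full: "L S s \<Longrightarrow> full S"
  by (rule low_nonempty)

definition "w0 = (1 - p) ^ 4"
definition "w1 = p * (1 - p) ^ 3"
definition "w2 = p ^ 2 * (1 - p) ^ 2"
definition "w3 = p ^ 3 * (1 - p)"
definition "w4 = p ^ 4"
lemmas w_defs = w0_def w1_def w2_def w3_def w4_def

lemma w_nonneg: "0 \<le> w0" "0 \<le> w1" "0 \<le> w2" "0 \<le> w3" "0 \<le> w4"
  using p by (auto simp: w_defs)

lemma w_mono: "0 \<le> w2 - w3" "0 \<le> w2 - w4" "0 \<le> w1 - w4"
proof -
  have q: "0 \<le> 1 - 2 * p" "0 < p" "0 \<le> 1 - p" using p by auto
  have "0 \<le> p ^ 2 * (1 - p) * (1 - 2 * p)" using q by simp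
  also have "\<dots> = w2 - w3" unfolding w_defs by algebra
  finally show 1: "0 \<le> w2 - w3" .
  have "0 \<le> p ^ 3 * (1 - 2 * p)" using q by simp
  also have "\<dots> = w3 - w4" unfolding w_defs by algebra
  finally have 2: "0 \<le> w3 - w4" .
  have "0 \<le> p * (1 - p) ^ 2 * (1 - 2 * p)" using q by simp
  also have "\<dots> = w1 - w2" unfolding w_defs by algebra
  finally have 3: "0 \<le> w1 - w2" .
  show "0 \<le> w2 - w4" "0 \<le> w1 - w4" using 1 2 3 by auto
qed

lemma mass_eq_X:
  "mass p n Q = w4 * X {1, 2, 3, 4}
     + w3 * (X {1, 2, 3} + X {1, 2, 4} + X {1, 3, 4} + X {2, 3, 4})
     + w2 * (X {1, 2} + X {1, 3} + X {1, 4} + X {2, 3} + X {2, 4} + X {3, 4})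
     + w1 * (X {1} + X {2} + X {3} + X {4}) + w0 * X {}"
proof -
  define m where "m = n - 4"
  have m: "n = Suc (Suc (Suc (Suc m)))" "n - 4 = m"
    using n by (auto simp: m_def)
  show ?thesis
    unfolding X_def pat_def w_defs m(2) unfolding m(1) by (simp, algebra)
qed

lemma mass_containing_1:
  "w4 * X {1, 2, 3, 4} + w3 * (X {1, 2, 3} + X {1, 2, 4} + X {1, 3, 4})
     + w2 * (X {1, 2} + X {1, 3} + X {1, 4}) + w1 * X {1} \<le> p ^ 2"
proof -
  define m where "m = n - 4"
  have m: "n - 1 = Suc (Suc (Suc m))" "n - 4 = m"
    using n by (auto simp: m_def)
  have "mass p (n - 1) (\<lambda>xs. Q ([True] @ xs)) \<le> p"
  proof (intro mass_intersecting up_closed_append)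
    fix xs assume xs: "length xs = n - 1" "Q ([True] @ xs)"
    have "Q ([False] @ replicate (n - 1) True)" using Q_234 by simp
    then show "\<not> Q ([True] @ map Not xs)"
      by (rule cross_intersecting_tails[OF _ _ xs(2,1)]) (use n in \<open>auto simp: free_def take_Cons'\<close>)
  qed (use p in auto)
  then have "p * mass p (n - 1) (\<lambda>xs. Q ([True] @ xs)) \<le> p * p"
    using p by simp
  also have "p * mass p (n - 1) (\<lambda>xs. Q ([True] @ xs)) = w4 * X {1, 2, 3, 4}
      + w3 * (X {1, 2, 3} + X {1, 2, 4} + X {1, 3, 4})
      + w2 * (X {1, 2} + X {1, 3} + X {1, 4}) + w1 * X {1}"
    unfolding X_def pat_def w_defs m(2) unfolding m(1) by (simp, algebra)
  finally show ?thesis by (simp add: power2_eq_square)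
qed

text \<open>The coefficient \<open>p\<^sup>2 (p - (1 - p)\<^sup>2)\<close> is \<open>w3
    + w4 - w2\<close>.\<close>

lemma sum_bound_full_23:
  assumes "full {2, 3}"
  shows "w4 * X {1, 2, 3, 4} + w3 * (X {1, 2, 3} + X {1, 2, 4} + X {1, 3, 4} + X {2, 3, 4})
      + w2 * X {1, 4} + p ^ 2 * (p - (1 - p) ^ 2) * X {1, 4}
    \<le> w4 + w3 * (2 + p)"
proof -
  have "X {2, 3, 4} \<le> p"
    by (rule X_le_p[OF full_12]) (simp add: free_pat pat_eval)
  then have 1: "w3 * X {2, 3, 4} \<le> w3 * p"
    by (intro mult_left_mono w_nonneg)
  have "X {1, 2, 3} + X {1, 4} \<le> 1"
    by (rule X_add_le_1[OF full_234]) (simp add: free_pat pat_eval)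
  then have 2: "w3 * (X {1, 2, 3} + X {1, 4}) \<le> w3 * 1"
    by (intro mult_left_mono w_nonneg)
  have "X {1, 4} + X {1, 2, 3, 4} \<le> 1"
    by (rule X_add_le_1[OF assms]) (simp add: free_pat pat_eval)
  then have 3: "w4 * (X {1, 4} + X {1, 2, 3, 4}) \<le> w4 * 1"
    by (intro mult_left_mono w_nonneg)
  have "X {1, 2, 4} + X {1, 3, 4} \<le> 1"
    by (rule X_add_le_1[OF assms]) (simp add: free_pat pat_eval)
  then have 4: "w3 * (X {1, 2, 4} + X {1, 3, 4}) \<le> w3 * 1"
    by (intro mult_left_mono w_nonneg)
  have eq: "p ^ 2 * (p - (1 - p) ^ 2) = w3 + w4 - w2"
    unfolding w_defs by algebra
  show ?thesis
    unfolding eq using 1 2 3 4 by (simp only: algebra_simps; linarith)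
qed

lemma coeff_14_nonneg: "0 \<le> p ^ 2 * (p - (1 - p) ^ 2)"
proof -
  have "(1 - p) ^ 2 \<le> (3/5) ^ 2" using p by (intro power_mono) auto
  then have "(1 - p) ^ 2 \<le> p" using p(1) by (simp add: power2_eq_square)
  then show ?thesis by simp
qed

lemma mass_less_L23_3:
  assumes h: "L {2, 3} 3"
  shows "mass p n Q < 4 * p ^ 3 * (1 - p) + p ^ 4 - 0.0018"
proof -
  have facts:
    "X {1, 2} \<le> chord 3 p"
    "X {1, 3} \<le> chord 3 p"
    "X {2, 3} \<le> chord 3 p"
    "X {2, 4} \<le> chord 3 p"
    "X {3, 4} \<le> chord 3 p"
    "X {1} \<le> chord 6 p"
    "X {2} \<le> chord 6 p"
    "X {3} \<le> chord 6 p"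
    "X {4} \<le> chord 6 p"
    "X {} \<le> chord 9 p"
  proof -
    show "X {1, 2} \<le> chord 3 p"
      by (rule X_le_chord[OF h h]; simp add: free_pat pat_eval)
    show "X {1, 3} \<le> chord 3 p"
      by (rule X_le_chord[OF h h]; simp add: free_pat pat_eval)
    show "X {2, 3} \<le> chord 3 p"
      by (rule X_le_chord[OF h h]; simp add: free_pat pat_eval)
    show "X {2, 4} \<le> chord 3 p"
      by (rule X_le_chord[OF h h]; simp add: free_pat pat_eval)
    show "X {3, 4} \<le> chord 3 p"
      by (rule X_le_chord[OF h h]; simp add: free_pat pat_eval)
    show "X {1} \<le> chord 6 p"
      by (rule X_le_chord[OF h h]; simp add: free_pat pat_eval)
    show "X {2} \<le> chord 6 p"
      by (rule X_le_chord[OF h h]; simp add: free_pat pat_eval)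
    show "X {3} \<le> chord 6 p"
      by (rule X_le_chord[OF h h]; simp add: free_pat pat_eval)
    show "X {4} \<le> chord 6 p"
      by (rule X_le_chord[OF h h]; simp add: free_pat pat_eval)
    show "X {} \<le> chord 9 p"
      by (rule X_le_chord[OF h h]; simp add: free_pat pat_eval)
  qed
  have p0: "w2 * (X {1, 2} + X {1, 3} + X {2, 3} + X {2, 4} + X {3, 4}) \<le> w2 * (5 * chord 3 p)"
    by (intro mult_left_mono w_nonneg) (use facts in linarith)
  have p1: "w1 * (X {1} + X {2} + X {3} + X {4}) \<le> w1 * (4 * chord 6 p)"
    by (intro mult_left_mono w_nonneg) (use facts in linarith)
  have p2: "w0 * X {} \<le> w0 * chord 9 p"
    by (intro mult_left_mono w_nonneg) (use facts in linarith)
  have ext: "w4 * X {1, 2, 3, 4} + w3 * (X {1, 2, 3} + X {1, 2, 4} + X {1, 3, 4} + X {2, 3, 4})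
      + w2 * X {1, 4} \<le> w4 + w3 * (2 + p)"
    using sum_bound_full_23[OF L_full[OF h]]
      mult_nonneg_nonneg[OF coeff_14_nonneg X_nonneg[of "{1, 4}"]]
    by linarith
  have "mass p n Q \<le> w4 + w3 * (2 + p) + w2 * (5 * chord 3 p) + w1 * (4 * chord 6 p)
      + w0 * chord 9 p"
    using p0 p1 p2 ext unfolding mass_eq_X by (simp only: algebra_simps; linarith)
  also have "\<dots> < 4 * p ^ 3 * (1 - p) + p ^ 4 - 0.0018"
    unfolding w_defs by (rule chord_poly_L23_3[OF p])
  finally show ?thesis .
qed

lemma mass_less_L23_L12:
  assumes h23: "L {2, 3} 4" and n23: "\<not> L {2, 3} 3" and h12: "L {1, 2} 2"
  shows "mass p n Q < 4 * p ^ 3 * (1 - p) + p ^ 4 - 0.0018"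
proof -
  have facts:
    "X {1, 2} \<le> chord 1 p"
    "X {1, 3} \<le> chord 3 p"
    "X {3, 4} \<le> chord 5 p"
    "X {2, 3} \<le> chord 4 p"
    "X {2, 4} \<le> X {2, 3}"
    "X {1} \<le> chord 6 p"
    "X {2} \<le> chord 6 p"
    "X {3} \<le> chord 8 p"
    "X {4} \<le> chord 8 p"
    "X {} \<le> chord 9 p"
  proof -
    show "X {1, 2} \<le> chord 1 p"
      by (rule X_le_chord[OF h23 h23]; simp add: free_pat pat_eval)
    show "X {1, 3} \<le> chord 3 p"
      by (rule X_le_chord[OF h12 h23]; simp add: free_pat pat_eval)
    show "X {3, 4} \<le> chord 5 p"
      by (rule X_le_chord[OF h12 h12]; simp add: free_pat pat_eval)
    show "X {2, 3} \<le> chord 4 p"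
      by (rule X_le_chord_not_L[OF n23]; simp)
    show "X {2, 4} \<le> X {2, 3}"
      by (rule X_mono; simp add: pat_eval)
    show "X {1} \<le> chord 6 p"
      by (rule X_le_chord[OF h12 h23]; simp add: free_pat pat_eval)
    show "X {2} \<le> chord 6 p"
      by (rule X_le_chord[OF h12 h23]; simp add: free_pat pat_eval)
    show "X {3} \<le> chord 8 p"
      by (rule X_le_chord[OF h12 h12]; simp add: free_pat pat_eval)
    show "X {4} \<le> chord 8 p"
      by (rule X_le_chord[OF h12 h12]; simp add: free_pat pat_eval)
    show "X {} \<le> chord 9 p"
      by (rule X_le_chord[OF h12 h12]; simp add: free_pat pat_eval)
  qed
  have p0: "w2 * (X {1, 2} + X {1, 3} + X {3, 4} + X {2, 3} + X {2, 4}) \<le> w2 * (chord 1 p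
      + chord 3 p + chord 5 p + 2 * chord 4 p)"
    by (intro mult_left_mono w_nonneg) (use facts in linarith)
  have p1: "w1 * (X {1} + X {2} + X {3} + X {4}) \<le> w1 * (2 * chord 6 p + 2 * chord 8 p)"
    by (intro mult_left_mono w_nonneg) (use facts in linarith)
  have p2: "w0 * X {} \<le> w0 * chord 9 p"
    by (intro mult_left_mono w_nonneg) (use facts in linarith)
  have ext: "w4 * X {1, 2, 3, 4} + w3 * (X {1, 2, 3} + X {1, 2, 4} + X {1, 3, 4} + X {2, 3, 4})
      + w2 * X {1, 4} \<le> w4 + w3 * (2 + p)"
    using sum_bound_full_23[OF L_full[OF h23]]
      mult_nonneg_nonneg[OF coeff_14_nonneg X_nonneg[of "{1, 4}"]]
    by linarith
  have "mass p n Q \<le> w4 + w3 * (2 + p) + w2 * (chord 1 p + chord 3 p + chord 5 p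
      + 2 * chord 4 p) + w1 * (2 * chord 6 p + 2 * chord 8 p) + w0 * chord 9 p"
    using p0 p1 p2 ext unfolding mass_eq_X by (simp only: algebra_simps; linarith)
  also have "\<dots> < 4 * p ^ 3 * (1 - p) + p ^ 4 - 0.0018"
    unfolding w_defs by (rule chord_poly_L23_L12[OF p])
  finally show ?thesis .
qed

lemma mass_less_L23_not_L12:
  assumes h23: "L {2, 3} 4" and n23: "\<not> L {2, 3} 3" and n12: "\<not> L {1, 2} 2"
  shows "mass p n Q < 4 * p ^ 3 * (1 - p) + p ^ 4 - 0.0018"
proof -
  have facts:
    "X {1, 2} \<le> chord 3 p"
    "X {1, 3} \<le> X {1, 2}"
    "X {2, 3} \<le> chord 4 p"
    "X {2, 4} \<le> X {2, 3}"
    "X {3, 4} \<le> X {2, 3}"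
    "X {1} \<le> X {1, 4}"
    "X {1} \<le> chord 4 p"
    "X {2} \<le> chord 4 p"
    "X {3} \<le> chord 4 p"
    "X {4} \<le> chord 4 p"
    "X {} \<le> chord 7 p"
  proof -
    show "X {1, 2} \<le> chord 3 p"
      by (rule X_le_chord_not_L[OF n12]; simp)
    show "X {1, 3} \<le> X {1, 2}"
      by (rule X_mono; simp add: pat_eval)
    show "X {2, 3} \<le> chord 4 p"
      by (rule X_le_chord_not_L[OF n23]; simp)
    show "X {2, 4} \<le> X {2, 3}"
      by (rule X_mono; simp add: pat_eval)
    show "X {3, 4} \<le> X {2, 3}"
      by (rule X_mono; simp add: pat_eval)
    show "X {1} \<le> X {1, 4}"
      by (rule X_mono; simp add: pat_eval)
    show "X {1} \<le> chord 4 p"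
      by (rule X_le_chord[OF h23 h23]; simp add: free_pat pat_eval)
    show "X {2} \<le> chord 4 p"
      by (rule X_le_chord[OF h23 h23]; simp add: free_pat pat_eval)
    show "X {3} \<le> chord 4 p"
      by (rule X_le_chord[OF h23 h23]; simp add: free_pat pat_eval)
    show "X {4} \<le> chord 4 p"
      by (rule X_le_chord[OF h23 h23]; simp add: free_pat pat_eval)
    show "X {} \<le> chord 7 p"
      by (rule X_le_chord[OF h23 h23]; simp add: free_pat pat_eval)
  qed
  have pos: "0 \<le> p * (1 - 2 * p)"
    using p by simp
  have p0: "w2 * (X {1, 2} + X {1, 3} + X {2, 3} + X {2, 4}
      + X {3, 4}) \<le> w2 * (2 * chord 3 p + 3 * chord 4 p)"
    by (intro mult_left_mono w_nonneg) (use facts in linarith)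
  have p1: "w1 * (X {2} + X {3} + X {4}) \<le> w1 * (3 * chord 4 p)"
    by (intro mult_left_mono w_nonneg) (use facts in linarith)
  have p2: "(p * (1 - 2 * p)) * X {1} \<le> (p * (1 - 2 * p)) * chord 4 p"
    by (intro mult_left_mono pos) (use facts in linarith)
  have p3: "w0 * X {} \<le> w0 * chord 7 p"
    by (intro mult_left_mono w_nonneg) (use facts in linarith)
  have "p ^ 2 * (p - (1 - p) ^ 2) * X {1} \<le> p ^ 2 * (p - (1 - p) ^ 2) * X {1, 4}"
    by (intro mult_left_mono coeff_14_nonneg) (use facts in linarith)
  moreover have "w1 - p ^ 2 * (p - (1 - p) ^ 2) = p * (1 - 2 * p)"
    unfolding w_defs by algebra
  then have "w1 * X {1} - p ^ 2 * (p - (1 - p) ^ 2) * X {1} = p * (1 - 2 * p) * X {1}"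
    by (simp only: left_diff_distrib[symmetric])
  ultimately have ext: "w4 * X {1, 2, 3, 4} + w3 * (X {1, 2, 3} + X {1, 2, 4} + X {1, 3, 4}
      + X {2, 3, 4}) + w2 * X {1, 4} + w1 * X {1}
      \<le> w4 + w3 * (2 + p) + p * (1 - 2 * p) * X {1}"
    using sum_bound_full_23[OF L_full[OF h23]] by linarith
  have "mass p n Q \<le> w4 + w3 * (2 + p) + w2 * (2 * chord 3 p + 3 * chord 4 p) + (3 * w1
      + p * (1 - 2 * p)) * chord 4 p + w0 * chord 7 p"
    using p0 p1 p2 p3 ext unfolding mass_eq_X by (simp only: algebra_simps; linarith)
  also have "\<dots> < 4 * p ^ 3 * (1 - p) + p ^ 4 - 0.0018"
    unfolding w_defs by (rule chord_poly_L23_not_L12[OF p])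
  finally show ?thesis .
qed

lemma mass_less_not_L23_not_L12:
  assumes n23: "\<not> L {2, 3} 4" and n12: "\<not> L {1, 2} 2"
  shows "mass p n Q < 4 * p ^ 3 * (1 - p) + p ^ 4 - 0.0018"
proof -
  have facts:
    "X {1, 2} \<le> chord 3 p"
    "X {1, 3} \<le> X {1, 2}"
    "X {1, 4} \<le> X {1, 2}"
    "X {1} \<le> X {1, 2}"
    "X {2, 3} \<le> chord 5 p"
    "X {2, 4} \<le> X {2, 3}"
    "X {3, 4} \<le> X {2, 3}"
    "X {2} \<le> X {2, 3}"
    "X {3} \<le> X {2, 3}"
    "X {4} \<le> X {2, 3}"
    "X {} \<le> X {2, 3}"
    "X {1} + X {1, 2, 3, 4} \<le> 1"
    "X {1, 3, 4} + X {2, 3, 4} \<le> 1"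
    "X {1, 3} + X {1, 2, 4} \<le> 1"
    "X {1, 2, 3} + X {1, 4} \<le> 1"
  proof -
    show "X {1, 2} \<le> chord 3 p"
      by (rule X_le_chord_not_L[OF n12]; simp)
    show "X {1, 3} \<le> X {1, 2}"
      by (rule X_mono; simp add: pat_eval)
    show "X {1, 4} \<le> X {1, 2}"
      by (rule X_mono; simp add: pat_eval)
    show "X {1} \<le> X {1, 2}"
      by (rule X_mono; simp add: pat_eval)
    show "X {2, 3} \<le> chord 5 p"
      by (rule X_le_chord_not_L[OF n23]; simp)
    show "X {2, 4} \<le> X {2, 3}"
      by (rule X_mono; simp add: pat_eval)
    show "X {3, 4} \<le> X {2, 3}"
      by (rule X_mono; simp add: pat_eval)
    show "X {2} \<le> X {2, 3}"
      by (rule X_mono; simp add: pat_eval)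
    show "X {3} \<le> X {2, 3}"
      by (rule X_mono; simp add: pat_eval)
    show "X {4} \<le> X {2, 3}"
      by (rule X_mono; simp add: pat_eval)
    show "X {} \<le> X {2, 3}"
      by (rule X_mono; simp add: pat_eval)
    show "X {1} + X {1, 2, 3, 4} \<le> 1"
      by (rule X_add_le_1[OF full_234]; simp add: free_pat pat_eval)
    show "X {1, 3, 4} + X {2, 3, 4} \<le> 1"
      by (rule X_add_le_1[OF full_12]; simp add: free_pat pat_eval)
    show "X {1, 3} + X {1, 2, 4} \<le> 1"
      by (rule X_add_le_1[OF full_234]; simp add: free_pat pat_eval)
    show "X {1, 2, 3} + X {1, 4} \<le> 1"
      by (rule X_add_le_1[OF full_234]; simp add: free_pat pat_eval)
  qed
  have p0: "w4 * (X {1} + X {1, 2, 3, 4}) \<le> w4 * 1"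
    by (intro mult_left_mono w_nonneg) (use facts in linarith)
  have p1: "w3 * (X {1, 3, 4} + X {2, 3, 4} + X {1, 3} + X {1, 2, 4} + X {1, 2, 3}
      + X {1, 4}) \<le> w3 * 3"
    by (intro mult_left_mono w_nonneg) (use facts in linarith)
  have p2: "w2 * X {1, 2} \<le> w2 * chord 3 p"
    by (intro mult_left_mono w_nonneg) (use facts in linarith)
  have p3: "(w2 - w3) * (X {1, 3} + X {1, 4}) \<le> (w2 - w3) * (2 * chord 3 p)"
    by (intro mult_left_mono w_mono) (use facts in linarith)
  have p4: "(w1 - w4) * X {1} \<le> (w1 - w4) * chord 3 p"
    by (intro mult_left_mono w_mono) (use facts in linarith)
  have p5: "w2 * (X {2, 3} + X {2, 4} + X {3, 4}) \<le> w2 * (3 * chord 5 p)"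
    by (intro mult_left_mono w_nonneg) (use facts in linarith)
  have p6: "w1 * (X {2} + X {3} + X {4}) \<le> w1 * (3 * chord 5 p)"
    by (intro mult_left_mono w_nonneg) (use facts in linarith)
  have p7: "w0 * X {} \<le> w0 * chord 5 p"
    by (intro mult_left_mono w_nonneg) (use facts in linarith)
  have "mass p n Q \<le> w4 + 3 * w3 + (w2 + 2 * (w2 - w3) + w1 - w4) * chord 3 p + (3 * w2
      + 3 * w1 + w0) * chord 5 p"
    using p0 p1 p2 p3 p4 p5 p6 p7 unfolding mass_eq_X by (simp only: algebra_simps; linarith)
  also have "\<dots> < 4 * p ^ 3 * (1 - p) + p ^ 4 - 0.0018"
    unfolding w_defs by (rule chord_poly_not_L23_not_L12[OF p])
  finally show ?thesis .
qed

lemma mass_less_not_L23_L12_L234: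
  assumes n23: "\<not> L {2, 3} 4" and h12: "L {1, 2} 2" and h234: "L {2, 3, 4} 1"
  shows "mass p n Q < 4 * p ^ 3 * (1 - p) + p ^ 4 - 0.0018"
proof -
  have h134: "L {1, 3, 4} 1"
    by (rule L_mono[OF h234]) (simp add: pat_eval)
  have facts:
    "X {1, 2} \<le> chord 1 p"
    "X {1, 3} \<le> chord 3 p"
    "X {1, 4} \<le> X {1, 3}"
    "X {2, 3} \<le> chord 5 p"
    "X {2, 4} \<le> X {2, 3}"
    "X {3, 4} \<le> X {2, 3}"
    "X {1} \<le> chord 6 p"
    "X {2} \<le> chord 6 p"
    "X {3} \<le> chord 8 p"
    "X {4} \<le> chord 8 p"
    "X {} \<le> chord 9 p"
    "X {3, 4} + X {1, 2, 3, 4} \<le> 1"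
    "X {1, 2} + X {1, 3, 4} \<le> 1"
    "X {2, 3, 4} \<le> p"
    "X {1, 3} + X {1, 2, 4} \<le> 1"
    "X {1, 2, 3} + X {1, 4} \<le> 1"
  proof -
    show "X {1, 2} \<le> chord 1 p"
      by (rule X_le_chord[OF h134 h234]; simp add: free_pat pat_eval)
    show "X {1, 3} \<le> chord 3 p"
      by (rule X_le_chord[OF h12 h234]; simp add: free_pat pat_eval)
    show "X {1, 4} \<le> X {1, 3}"
      by (rule X_mono; simp add: pat_eval)
    show "X {2, 3} \<le> chord 5 p"
      by (rule X_le_chord_not_L[OF n23]; simp)
    show "X {2, 4} \<le> X {2, 3}"
      by (rule X_mono; simp add: pat_eval)
    show "X {3, 4} \<le> X {2, 3}"
      by (rule X_mono; simp add: pat_eval)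
    show "X {1} \<le> chord 6 p"
      by (rule X_le_chord[OF h12 h234]; simp add: free_pat pat_eval)
    show "X {2} \<le> chord 6 p"
      by (rule X_le_chord[OF h12 h234]; simp add: free_pat pat_eval)
    show "X {3} \<le> chord 8 p"
      by (rule X_le_chord[OF h12 h12]; simp add: free_pat pat_eval)
    show "X {4} \<le> chord 8 p"
      by (rule X_le_chord[OF h12 h12]; simp add: free_pat pat_eval)
    show "X {} \<le> chord 9 p"
      by (rule X_le_chord[OF h12 h12]; simp add: free_pat pat_eval)
    show "X {3, 4} + X {1, 2, 3, 4} \<le> 1"
      by (rule X_add_le_1[OF full_12]; simp add: free_pat pat_eval)
    show "X {1, 2} + X {1, 3, 4} \<le> 1"
      by (rule X_add_le_1[OF full_234]; simp add: free_pat pat_eval)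
    show "X {2, 3, 4} \<le> p"
      by (rule X_le_p[OF full_12]; simp add: free_pat pat_eval)
    show "X {1, 3} + X {1, 2, 4} \<le> 1"
      by (rule X_add_le_1[OF full_234]; simp add: free_pat pat_eval)
    show "X {1, 2, 3} + X {1, 4} \<le> 1"
      by (rule X_add_le_1[OF full_234]; simp add: free_pat pat_eval)
  qed
  have p0: "w4 * (X {3, 4} + X {1, 2, 3, 4}) \<le> w4 * 1"
    by (intro mult_left_mono w_nonneg) (use facts in linarith)
  have p1: "w3 * (X {1, 2} + X {1, 3, 4} + X {2, 3, 4} + X {1, 3} + X {1, 2, 4} + X {1, 2, 3}
      + X {1, 4}) \<le> w3 * (3 + p)"
    by (intro mult_left_mono w_nonneg) (use facts in linarith)
  have p2: "(w2 - w3) * (X {1, 2} + X {1, 3} + X {1, 4}) \<le> (w2 - w3) * (chord 1 p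
      + 2 * chord 3 p)"
    by (intro mult_left_mono w_mono) (use facts in linarith)
  have p3: "(w2 - w4) * X {3, 4} \<le> (w2 - w4) * chord 5 p"
    by (intro mult_left_mono w_mono) (use facts in linarith)
  have p4: "w2 * (X {2, 3} + X {2, 4}) \<le> w2 * (2 * chord 5 p)"
    by (intro mult_left_mono w_nonneg) (use facts in linarith)
  have p5: "w1 * (X {1} + X {2} + X {3} + X {4}) \<le> w1 * (2 * chord 6 p + 2 * chord 8 p)"
    by (intro mult_left_mono w_nonneg) (use facts in linarith)
  have p6: "w0 * X {} \<le> w0 * chord 9 p"
    by (intro mult_left_mono w_nonneg) (use facts in linarith)
  have "mass p n Q \<le> w4 + w3 * (3 + p) + (w2 - w3) * (chord 1 p + 2 * chord 3 p)
      + (w2 - w4) * chord 5 p + w2 * (2 * chord 5 p) + w1 * (2 * chord 6 p + 2 * chord 8 p)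
      + w0 * chord 9 p"
    using p0 p1 p2 p3 p4 p5 p6 unfolding mass_eq_X by (simp only: algebra_simps; linarith)
  also have "\<dots> < 4 * p ^ 3 * (1 - p) + p ^ 4 - 0.0018"
    unfolding w_defs by (rule chord_poly_not_L23_L12_L234[OF p])
  finally show ?thesis .
qed

lemma mass_less_not_L23_L12_not_L234:
  assumes n23: "\<not> L {2, 3} 4" and h12: "L {1, 2} 2" and n234: "\<not> L {2, 3, 4} 1"
  shows "mass p n Q < 4 * p ^ 3 * (1 - p) + p ^ 4 - 0.0018"
proof -
  have facts:
    "X {2, 3} \<le> chord 5 p"
    "X {2, 4} \<le> X {2, 3}"
    "X {3, 4} \<le> X {2, 3}"
    "X {2} \<le> X {2, 3}"
    "X {2, 3, 4} \<le> chord 2 p"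
    "X {3} \<le> chord 8 p"
    "X {4} \<le> chord 8 p"
    "X {} \<le> chord 9 p"
  proof -
    show "X {2, 3} \<le> chord 5 p"
      by (rule X_le_chord_not_L[OF n23]; simp)
    show "X {2, 4} \<le> X {2, 3}"
      by (rule X_mono; simp add: pat_eval)
    show "X {3, 4} \<le> X {2, 3}"
      by (rule X_mono; simp add: pat_eval)
    show "X {2} \<le> X {2, 3}"
      by (rule X_mono; simp add: pat_eval)
    show "X {2, 3, 4} \<le> chord 2 p"
      by (rule X_le_chord_not_L[OF n234]; simp)
    show "X {3} \<le> chord 8 p"
      by (rule X_le_chord[OF h12 h12]; simp add: free_pat pat_eval)
    show "X {4} \<le> chord 8 p"
      by (rule X_le_chord[OF h12 h12]; simp add: free_pat pat_eval)
    show "X {} \<le> chord 9 p"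
      by (rule X_le_chord[OF h12 h12]; simp add: free_pat pat_eval)
  qed
  have p0: "w3 * X {2, 3, 4} \<le> w3 * chord 2 p"
    by (intro mult_left_mono w_nonneg) (use facts in linarith)
  have p1: "w2 * (X {2, 3} + X {2, 4} + X {3, 4}) \<le> w2 * (3 * chord 5 p)"
    by (intro mult_left_mono w_nonneg) (use facts in linarith)
  have p2: "w1 * (X {2} + X {3} + X {4}) \<le> w1 * (chord 5 p + 2 * chord 8 p)"
    by (intro mult_left_mono w_nonneg) (use facts in linarith)
  have p3: "w0 * X {} \<le> w0 * chord 9 p"
    by (intro mult_left_mono w_nonneg) (use facts in linarith)
  note ext = mass_containing_1
  have "mass p n Q \<le> p ^ 2 + w3 * chord 2 p + w2 * (3 * chord 5 p) + w1 * (chord 5 p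
      + 2 * chord 8 p) + w0 * chord 9 p"
    using p0 p1 p2 p3 ext unfolding mass_eq_X by (simp only: algebra_simps; linarith)
  also have "\<dots> < 4 * p ^ 3 * (1 - p) + p ^ 4 - 0.0018"
    unfolding w_defs by (rule chord_poly_not_L23_L12_not_L234[OF p])
  finally show ?thesis .
qed

lemma mass_less: "mass p n Q < 4 * p ^ 3 * (1 - p) + p ^ 4 - 0.0018"
  using mass_less_L23_3 mass_less_L23_L12 mass_less_L23_not_L12 mass_less_not_L23_not_L12
    mass_less_not_L23_L12_L234 mass_less_not_L23_L12_not_L234
  by blast

end

lemma p_measure_BD3:
  assumes "4 \<le> n"
  shows "p_measure n p (BD3 n) = 4 * p ^ 3 * (1 - p) + p ^ 4"
proof -
  define m where "m = n - 4"
  have m: "n = Suc (Suc (Suc (Suc m)))"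
    using assms by (auto simp: m_def)
  have "{1..4} = {1..<1 + (4::nat)}" by auto
  then have "BD3 n = {G \<in> Pow {1..n}. 3 \<le> trues 4 (bits 1 n G)}"
    using assms by (simp add: BD3_def trues_bits)
  then have "p_measure n p (BD3 n) = mass p n (\<lambda>xs. 3 \<le> trues 4 xs)"
    by (simp only: p_measure_bits[of n p "\<lambda>xs. 3 \<le> trues 4 xs"])
  also have "\<dots> = 4 * p ^ 3 * (1 - p) + p ^ 4"
    unfolding m by (simp add: mass_const, algebra)
  finally show ?thesis .
qed

theorem theorem6:
  fixes n :: nat and p :: real and \<F> :: "nat set set"
  assumes "2/5 \<le> p" and "p \<le> 1/2"
    and "\<F> \<subseteq> Pow {1..n}"
    and "shifted n \<F>"
    and "nontrivial \<F>"
    and "three_wise_intersecting \<F>"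
    and "\<not> \<F> \<subseteq> BD3 n"
  shows "p_measure n p \<F> < p_measure n p (BD3 n) - 0.0018"
proof -
  define Q where "Q xs \<longleftrightarrow> (\<exists>G\<in>\<F>. dominated (bits 1 n G) xs)" for xs
  interpret prefix_family n Q
  proof
    show "Q ys" if "Q xs" "dominated xs ys" for xs ys
      using that unfolding Q_def dominated_def by (metis order_trans)
    show "\<exists>l\<le>n. 2 * l < trues l xs + trues l ys + trues l zs"
      if Q: "Q xs" "Q ys" "Q zs" for xs ys zs
    proof -
      obtain A where A: "A \<in> \<F>" "dominated (bits 1 n A) xs"
        using Q(1) unfolding Q_def by blast
      obtain B where B: "B \<in> \<F>" "dominated (bits 1 n B) ys"
        using Q(2) unfolding Q_def by blast
      obtain C where C: "C \<in> \<F>" "dominated (bits 1 n C) zs"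
        using Q(3) unfolding Q_def by blast
      have le: "trues l (bits 1 n A) \<le> trues l xs" "trues l (bits 1 n B) \<le> trues l ys"
        "trues l (bits 1 n C) \<le> trues l zs" for l
        using A(2) B(2) C(2) unfolding dominated_def by blast+
      obtain l where l: "l \<le> n"
        "2 * l < card (A \<inter> {1..l}) + card (B \<inter> {1..l}) + card (C \<inter> {1..l})"
        using shifted_prefix_condition[OF assms(3,4,6) A(1) B(1) C(1)] by blast
      have eq: "{1..l} = {1..<1 + l}" by auto
      show ?thesis
        using l le[of l] unfolding eq by (intro exI[of _ l]) (simp add: trues_bits)
    qed
  qed
  have dom_bits: "dominated (bits 1 n G) ys"
    if "length ys = n" "\<And>l. l \<le> n \<Longrightarrow> card (G \<inter> {1..<1
        + l}) \<le> trues l ys" for G ys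
    unfolding dominated_def
  proof (intro conjI allI)
    fix l
    have "trues (min l n) (bits 1 n G) \<le> trues (min l n) ys"
      using that(2)[of "min l n"] by (simp add: trues_bits)
    then show "trues l (bits 1 n G) \<le> trues l ys"
      using that(1) by (simp add: min_def split: if_splits)
  qed (use that in simp)
  have "\<F> \<noteq> {}" using assms(7) by auto
  then have "n \<noteq> 0"
    using assms(3,6) unfolding three_wise_intersecting_def by fastforce
  then obtain k where k: "n = Suc k" by (cases n) auto
  obtain G where G: "G \<in> \<F>" "1 \<notin> G"
    using assms(5) unfolding nontrivial_def by blast
  have Q_234: "Q (False # replicate (n - 1) True)"
    unfolding Q_def
  proof (rule bexI[OF dom_bits G(1)])
    fix l assume "l \<le> n"
    have "card (G \<inter> {1..<1 + l}) \<le> card {2..<1 + l}"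
      using G(2) by (intro card_mono) (auto simp: Suc_le_eq le_less)
    also have "\<dots> \<le> trues l (False # replicate (n - 1) True)"
      using \<open>l \<le> n\<close> k by (cases l) (auto simp: trues_replicate simp del: take_replicate)
    finally show "card (G \<inter> {1..<1 + l}) \<le> trues l (False # replicate (n - 1) True)" .
  qed (use k in simp)
  obtain l where l: "l \<le> n" "2 * l < 3 * trues l (False # replicate (n - 1) True)"
    using prefix_condition[OF Q_234 Q_234 Q_234] by auto
  then have n: "4 \<le> n"
    by (cases l) (auto simp: trues_replicate simp del: take_replicate)
  obtain H where H: "H \<in> \<F>" "card (H \<inter> {1..4}) \<le> 2"
    using assms(3,7) unfolding BD3_def by fastforce
  have Q_12: "Q ([True, True, False, False] @ replicate (n - 4) True)"
    unfolding Q_def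
  proof (rule bexI[OF dom_bits H(1)])
    fix l assume "l \<le> n"
    have le: "card (H \<inter> {1..<1 + l}) \<le> l"
      using card_mono[of "{1..<1 + l}" "H \<inter> {1..<1 + l}"] by simp
    have eq: "{1..<1 + l} \<subseteq> {1..4} \<union> {5..<1 + l}" by auto
    have "card (H \<inter> {1..<1 + l}) \<le> card ((H \<inter> {1..4}) \<union> {5..<1 + l})"
      using eq by (intro card_mono) auto
    also have "\<dots> \<le> card (H \<inter> {1..4}) + card {5..<1 + l}"
      by (rule card_Un_le)
    also have "\<dots> \<le> 2 + (l - 4)" using H(2) by simp
    finally have "card (H \<inter> {1..<1 + l}) \<le> min l (2 + (l - 4))" using le by simp
    also have "\<dots> \<le> trues l ([True, True, False, False] @ replicate (n - 4) True)"
      using \<open>l \<le> n\<close> by (auto simp: take_Cons' trues_replicate simp del: take_replicate)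
    finally show "card (H \<inter> {1..<1 + l})
      \<le> trues l ([True, True, False, False] @ replicate (n - 4) True)" .
  qed (use n in simp)
  interpret nontrivial_prefix_family n Q p
    by unfold_locales (use n assms(1,2) Q_234 Q_12 in auto)
  have "\<F> \<subseteq> {G \<in> Pow {1..n}. Q (bits 1 n G)}"
    using assms(3) by (auto simp: Q_def dominated_def)
  then have "p_measure n p \<F> \<le> mass p n Q"
    unfolding p_measure_bits[of n p Q, symmetric]
    by (rule p_measure_mono[OF p01(1,2)]) (auto intro: finite_subset[of _ "Pow {1..n}"])
  also have "\<dots> < 4 * p ^ 3 * (1 - p) + p ^ 4 - 0.0018"
    by (rule mass_less)
  finally show ?thesis by (simp only: p_measure_BD3[OF n])
qed

end
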